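(* Let $\beta$ be a unit-speed timelike curve in $\mathbb{E}^4_1$ with Frenet frame $\{F_1,F_2,F_3,F_4\}$, let $r>0$ be constant, and let $M$ be the tubular hypersurface $$\mathcal{T}(s,t,w)=\beta(s)+r(\cos t\cos w\,F_2(s)+\sin t\cos w\,F_3(s)+\sin w\,F_4(s))$$ in $\mathbb{E}^4_1$, with Gauss map $N=-(\cos t\cos w\,F_2+\sin t\cos w\,F_3+\sin w\,F_4)$. Then $M$ does not have generalized $\mathcal{L}_2$ 1-type Gauss map; that is, there do not exist non-zero smooth functions $\mathfrak{m},\mathfrak{n}$ on $M$ and a non-zero constant vector $C\in\mathbb{E}^4_1$ such that $\mathcal{L}_2N=\mathfrak{m}N+\mathfrak{n}C$.
   Context: $\mathbb{E}^4_1$ is $\mathbb{R}^4$ with the metric $\langle\ ,\ \rangle=-dx_1^2+dx_2^2+dx_3^2+dx_4^2$. The curve $\beta:I\to\mathbb{E}^4_1$ ($I$ an open interval) is smooth with $\beta'=F_1$, and $\{F_1,F_2,F_3,F_4\}$ is a smooth orthonormal frame along $\beta$ with $\langle F_1,F_1\rangle=-1$, $\langle F_i,F_i\rangle=1$ ($i=2,3,4$), satisfying the Frenet equations $F_1'=k_1F_2$, $F_2'=k_1F_1+k_2F_3$, $F_3'=-k_2F_2+k_3F_4$, $F_4'=-k_3F_3$, where $k_1,k_2,k_3$ are smooth functions of $s$ (the curvatures of $\beta$). The parameters $(s,t,w)$ range over a connected open set $U\subset I\times\mathbb{R}^2$ projecting onto $I$ on which $\mathcal{T}$ is an immersion, i.e.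 $\cos w\neq0$ and $1+rk_1\cos t\cos w\neq0$. The unit normal $N$ has $\varepsilon=\langle N,N\rangle=1$, and the principal curvatures with respect to $N$ (eigenvalues of the shape operator $-dN$) are $\kappa_1=\kappa_2=\frac1r$, $\kappa_3=\frac{k_1\cos t\cos w}{1+rk_1\cos t\cos w}$. Operator $\mathcal{L}_2$ on the Gauss map: put $a_1=-\sum_i\kappa_i$, $a_k=(-1)^k\sum_{i_1<\dots<i_k}\kappa_{i_1}\cdots\kappa_{i_k}$ ($k=2,3$), and define $H_k$ by $\binom{3}{k}H_k=(-\varepsilon)^ka_k$. Then $$\mathcal{L}_2N=-\varepsilon\,\mathfrak{C}_2\big(\nabla H_3+3H_1H_3\,N\big),\qquad \mathfrak{C}_2=\binom33(-\varepsilon)^2=1,$$ where $\nabla$ is the gradient on $M$ with respect to the induced metric, viewed as an $\mathbb{E}^4_1$-valued map. "Non-zero function" means not identically zero. *)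

theory Defs
  imports "HOL-Analysis.Analysis" "HOL-Computational_Algebra.Polynomial"
begin

definition mink :: "real^4 \<Rightarrow> real^4 \<Rightarrow> real" where
  "mink x y = - (x$1 * y$1) + x$2 * y$2 + x$3 * y$3 + x$4 * y$4"

text \<open>Continuous differentiability of order \<open>n\<close> and smoothness; meaningful for open \<open>S\<close> in a
  finite-dimensional space (all iterated directional derivatives exist as Frechet derivatives).\<close>

primrec Ck_on :: "nat \<Rightarrow> ('a::real_normed_vector \<Rightarrow> 'b::real_normed_vector) \<Rightarrow> 'a set \<Rightarrow> bool" where
  "Ck_on 0 f S \<longleftrightarrow> continuous_on S f"
| "Ck_on (Suc n) f S \<longleftrightarrow>
     (\<forall>x\<in>S. f differentiable (at x)) \<and> (\<forall>v. Ck_on n (\<lambda>x. frechet_derivative f (at x) v) S)"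

definition smooth_on :: "('a::real_normed_vector \<Rightarrow> 'b::real_normed_vector) \<Rightarrow> 'a set \<Rightarrow> bool" where
  "smooth_on f S \<longleftrightarrow> (\<forall>n. Ck_on n f S)"

definition timelike_frenet_curve ::
  "real set \<Rightarrow> (real \<Rightarrow> real^4) \<Rightarrow> (nat \<Rightarrow> real \<Rightarrow> real^4) \<Rightarrow> (nat \<Rightarrow> real \<Rightarrow> real) \<Rightarrow> bool" where
  "timelike_frenet_curve I \<beta> F k \<longleftrightarrow>
     smooth_on \<beta> I \<and> (\<forall>i\<in>{1..4}. smooth_on (F i) I) \<and> (\<forall>i\<in>{1..3}. smooth_on (k i) I) \<and>
     (\<forall>s\<in>I.
        (\<beta> has_vector_derivative F 1 s) (at s) \<and>
        (\<forall>i\<in>{1..4}. \<forall>j\<in>{1..4}.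
           mink (F i s) (F j s) = (if i \<noteq> j then 0 else if i = 1 then - 1 else 1)) \<and>
        (F 1 has_vector_derivative k 1 s *\<^sub>R F 2 s) (at s) \<and>
        (F 2 has_vector_derivative k 1 s *\<^sub>R F 1 s + k 2 s *\<^sub>R F 3 s) (at s) \<and>
        (F 3 has_vector_derivative - k 2 s *\<^sub>R F 2 s + k 3 s *\<^sub>R F 4 s) (at s) \<and>
        (F 4 has_vector_derivative - k 3 s *\<^sub>R F 3 s) (at s))"

text \<open>Hypersurfaces are given by parametrizations \<open>X\<close> on open subsets of \<open>real^3\<close>; functions and
  vector fields on the hypersurface are functions of the parameter \<open>p\<close>, and the tangent space at
  \<open>p\<close> is the range of the differential of \<open>X\<close>.  The parameters \<open>(s, t, w)\<close> are the components
  \<open>p$1\<close>, \<open>p$2\<close>, \<open>p$3\<close>.\<close>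

definition immersion_on :: "(real^3 \<Rightarrow> real^4) \<Rightarrow> (real^3) set \<Rightarrow> bool" where
  "immersion_on X U \<longleftrightarrow> smooth_on X U \<and> (\<forall>p\<in>U. inj (frechet_derivative X (at p)))"

text \<open>Gradient with respect to the induced metric, as an ambient vector.\<close>

definition grad :: "(real^3 \<Rightarrow> real^4) \<Rightarrow> (real^3 \<Rightarrow> real) \<Rightarrow> real^3 \<Rightarrow> real^4" where
  "grad X f p = (THE V. V \<in> range (frechet_derivative X (at p)) \<and>
     (\<forall>v. mink V (frechet_derivative X (at p) v) = frechet_derivative f (at p) v))"

text \<open>The shape operator \<open>-dN\<close>, pulled back along \<open>dX\<close> to an endomorphism of the parameter space.\<close>

definition shape_operator :: "(real^3 \<Rightarrow> real^4) \<Rightarrow> (real^3 \<Rightarrow> real^4) \<Rightarrow> real^3 \<Rightarrow> real^3 \<Rightarrow> real^3" where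
  "shape_operator X N p v =
     (THE u. frechet_derivative X (at p) u = - frechet_derivative N (at p) v)"

definition charpoly :: "real^'n^'n \<Rightarrow> real poly" where
  "charpoly A = det (mat [:0, 1:] - map_matrix (\<lambda>x. [:x:]) A)"

text \<open>The real eigenvalues of the shape operator, repeated by multiplicity (in increasing order).\<close>

definition principal_curvatures :: "(real^3 \<Rightarrow> real^4) \<Rightarrow> (real^3 \<Rightarrow> real^4) \<Rightarrow> real^3 \<Rightarrow> real list" where
  "principal_curvatures X N p =
     sorted_list_of_multiset (proots (charpoly (matrix (shape_operator X N p))))"

definition curv_coeff :: "(real^3 \<Rightarrow> real^4) \<Rightarrow> (real^3 \<Rightarrow> real^4) \<Rightarrow> nat \<Rightarrow> real^3 \<Rightarrow> real" where
  "curv_coeff X N k p = (let \<kappa> = principal_curvatures X N p in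
     (- 1) ^ k * (\<Sum>J | J \<subseteq> {..<length \<kappa>} \<and> card J = k. \<Prod>i\<in>J. \<kappa> ! i))"

definition normal_sign :: "(real^3 \<Rightarrow> real^4) \<Rightarrow> real^3 \<Rightarrow> real" where
  "normal_sign N p = mink (N p) (N p)"

definition mean_curv :: "(real^3 \<Rightarrow> real^4) \<Rightarrow> (real^3 \<Rightarrow> real^4) \<Rightarrow> nat \<Rightarrow> real^3 \<Rightarrow> real" where
  "mean_curv X N k p = (- normal_sign N p) ^ k * curv_coeff X N k p / real (3 choose k)"

definition L2_Gauss :: "(real^3 \<Rightarrow> real^4) \<Rightarrow> (real^3 \<Rightarrow> real^4) \<Rightarrow> real^3 \<Rightarrow> real^4" where
  "L2_Gauss X N p =
     (- normal_sign N p * (real (3 choose 3) * (- normal_sign N p) ^ 2)) *\<^sub>R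
       (grad X (mean_curv X N 3) p + (3 * mean_curv X N 1 p * mean_curv X N 3 p) *\<^sub>R N p)"

definition generalized_L2_1_type_Gauss_map ::
  "(real^3) set \<Rightarrow> (real^3 \<Rightarrow> real^4) \<Rightarrow> (real^3 \<Rightarrow> real^4) \<Rightarrow> bool" where
  "generalized_L2_1_type_Gauss_map U X N \<longleftrightarrow>
     (\<exists>(m :: real^3 \<Rightarrow> real) (n :: real^3 \<Rightarrow> real) (C :: real^4).
        smooth_on m U \<and> smooth_on n U \<and> (\<exists>p\<in>U. m p \<noteq> 0) \<and> (\<exists>p\<in>U. n p \<noteq> 0) \<and> C \<noteq> 0 \<and>
        (\<forall>p\<in>U. L2_Gauss X N p = m p *\<^sub>R N p + n p *\<^sub>R C))"

definition tube_normal :: "(nat \<Rightarrow> real \<Rightarrow> real^4) \<Rightarrow> real^3 \<Rightarrow> real^4" where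
  "tube_normal F p = - ((cos (p$2) * cos (p$3)) *\<^sub>R F 2 (p$1) + (sin (p$2) * cos (p$3)) *\<^sub>R F 3 (p$1)
     + sin (p$3) *\<^sub>R F 4 (p$1))"

definition tube :: "(real \<Rightarrow> real^4) \<Rightarrow> (nat \<Rightarrow> real \<Rightarrow> real^4) \<Rightarrow> real \<Rightarrow> real^3 \<Rightarrow> real^4" where
  "tube \<beta> F r p = \<beta> (p$1) + r *\<^sub>R ((cos (p$2) * cos (p$3)) *\<^sub>R F 2 (p$1)
     + (sin (p$2) * cos (p$3)) *\<^sub>R F 3 (p$1) + sin (p$3) *\<^sub>R F 4 (p$1))"

end

theory Submission
  imports Defs
begin

text \<open>Write \<open>\<nu> = - N = a F\<^sub>2 + b F\<^sub>3 + c F\<^sub>4\<close> and \<open>D = 1 + r k\<^sub>1 a\<close>. Then \<open>F\<^sub>1\<close> is a tangent principal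
  direction, \<open>H\<^sub>3 = k\<^sub>1 a / (r\<^sup>2 D)\<close>, and \<open>grad H\<^sub>3\<close> is a combination of \<open>F\<^sub>1\<close>, \<open>F\<^sub>2\<close> and \<open>\<nu>\<close> with coefficient
  \<open>B = k\<^sub>1 / (r\<^sup>3 D\<^sup>2)\<close> at \<open>F\<^sub>2\<close>. Hence so is \<open>n C\<close>, whatever \<open>m\<close> is. Where \<open>n \<noteq> 0\<close>, write \<open>c\<^sub>i = mink C F\<^sub>i\<close>, which depends
  on \<open>s\<close> only. Varying \<open>t\<close> and \<open>w\<close> forces \<open>c\<^sub>3 = c\<^sub>4 = 0\<close> and kills the \<open>\<nu>\<close>-component, so \<open>c\<^sub>2\<close> and \<open>k\<^sub>1\<close> have
  the same zeros. Differentiating \<open>c\<^sub>3 = 0\<close> gives \<open>k\<^sub>2 c\<^sub>2 = 0\<close>, hence \<open>k\<^sub>1 k\<^sub>2 = 0\<close>; the ratio of the first two components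
  then gives \<open>k\<^sub>1 c\<^sub>1 = 0\<close>, and differentiating this gives \<open>k\<^sub>1 = 0\<close>. So all \<open>c\<^sub>i\<close> vanish and \<open>C = 0\<close>.\<close>

section \<open>Linear algebra of the Minkowski form and of 3 by 3 matrices\<close>

lemma mink_simps:
  "mink (x + y) z = mink x z + mink y z" "mink z (x + y) = mink z x + mink z y"
  "mink (c *\<^sub>R x) z = c * mink x z" "mink z (c *\<^sub>R x) = c * mink z x"
  "mink (x - y) z = mink x z - mink y z" "mink z (x - y) = mink z x - mink z y"
  "mink (- x) z = - mink x z" "mink z (- x) = - mink z x"
  "mink 0 z = 0" "mink z 0 = 0"
  by (simp_all add: mink_def algebra_simps)

lemma mink_commute: "mink x y = mink y x"
  by (simp add: mink_def mult.commute)

lemma bounded_linear_mink: "bounded_linear (mink x)"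
  by (simp add: linear_conv_bounded_linear[symmetric] linear_iff mink_simps)

text \<open>Orthonormality says that the matrix with rows \<open>f i\<close> has an explicit right
  inverse. For square matrices this is also a left inverse, so only 0 is orthogonal to all
  rows.\<close>

lemma mink_orthonormal_frame_nondegenerate:
  fixes f :: "4 \<Rightarrow> real^4"
  assumes orth: "\<And>i j. mink (f i) (f j) = (if i \<noteq> j then 0 else if i = 1 then - 1 else 1)"
    and zero: "\<And>i. mink x (f i) = 0"
  shows "x = 0"
proof -
  \<comment> \<open>Lowering an index: \<open>\<eta>\<close> turns the Minkowski form into the
    Euclidean inner product.\<close>
  define \<eta> :: "real^4 \<Rightarrow> real^4" where "\<eta> y = (\<chi> i. if i = 1 then - y $ i else y $ i)" for y
  define A :: "real^4^4" where "A = (\<chi> i. f i)"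
  define B :: "real^4^4" where "B = transpose (\<chi> i. (if i = 1 then - 1 else 1) *\<^sub>R \<eta> (f i))"
  have inner_\<eta>: "y \<bullet> \<eta> z = mink y z" for y z
    by (simp add: inner_vec_def \<eta>_def mink_def sum_4)
  have "(A ** B) $ i $ j = (if j = 1 then - 1 else 1) * mink (f i) (f j)" for i j
    by (simp add: matrix_matrix_mult_def transpose_def A_def B_def mink_def \<eta>_def sum_4)
  then have "A ** B = mat 1"
    by (simp add: vec_eq_iff mat_def orth)
  then have BA: "B ** A = mat 1"
    by (simp add: matrix_left_right_inverse)
  have "A *v \<eta> x = 0"
    by (simp add: vec_eq_iff matrix_vector_mul_component A_def inner_\<eta> mink_commute[of "f _"] zero)
  then have "\<eta> x = 0"
    using BA by (metis matrix_vector_mul_assoc matrix_vector_mul_lid matrix_vector_mult_0_right)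
  then show "x = 0"
    by (simp add: \<eta>_def vec_eq_iff split: if_splits) (metis neg_equal_0_iff_equal)
qed

text \<open>The matrix is lower triangular, whatever its first column. This is the shape operator in
  the coordinates s, t, w, where the t- and w-directions are principal with equal curvature.\<close>

lemma charpoly_splits:
  fixes A :: "real^3^3"
  assumes "\<And>i. A $ i $ 2 = (if i = 2 then l else 0)" "\<And>i. A $ i $ 3 = (if i = 3 then l else 0)"
  shows "charpoly A = [:- l, 1:] * [:- l, 1:] * [:- A $ 1 $ 1, 1:]"
  by (simp add: charpoly_def det_3 mat_def map_matrix_def assms algebra_simps)

text \<open>The only index set of full size is the whole one; this makes the top symmetric function
  a product, independent of the order of the list.\<close>

lemma sum_prod_full_subsets:
  fixes xs :: "real list"
  shows "(\<Sum>J | J \<subseteq> {..<length xs} \<and> card J = length xs. \<Prod>i\<in>J. xs ! i) = prod_list xs"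
proof -
  have "{J. J \<subseteq> {..<length xs} \<and> card J = length xs} = {{..<length xs}}"
    using card_subset_eq[of "{..<length xs}"] by auto
  then show ?thesis
    by (simp add: prod.list_conv_set_nth atLeast0LessThan)
qed

section \<open>Room for varying s, t and w independently\<close>

lemma continuous_nonzero_on_box:
  fixes f :: "real^3 \<Rightarrow> real"
  assumes "open U" "continuous_on U f" "p \<in> U" "f p \<noteq> 0"
  obtains \<delta> where "\<delta> > 0"
    "\<And>s t w. \<bar>s - p$1\<bar> < \<delta> \<Longrightarrow> \<bar>t - p$2\<bar> < \<delta> \<Longrightarrow> \<bar>w - p$3\<bar> < \<delta> \<Longrightarrow>
       vector [s,t,w] \<in> U \<and> f (vector [s,t,w]) \<noteq> 0"
proof -
  have "{q \<in> U. f q \<noteq> 0} = U \<inter> f -` (- {0})" by auto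
  then have "open {q \<in> U. f q \<noteq> 0}"
    using continuous_open_preimage[OF assms(2,1), of "- {0}"] by auto
  moreover have "p \<in> {q \<in> U. f q \<noteq> 0}" using assms by simp
  ultimately obtain e where e: "e > 0" "ball p e \<subseteq> {q \<in> U. f q \<noteq> 0}"
    by (meson open_contains_ball)
  show thesis
  \<comment> \<open>The Euclidean norm is at most the sum of the three coordinate distances.\<close>
  proof (rule that[of "e / 3"])
    show "e / 3 > 0" using e by simp
    fix s t w assume st: "\<bar>s - p$1\<bar> < e/3" "\<bar>t - p$2\<bar> < e/3" "\<bar>w - p$3\<bar> < e/3"
    have "norm (vector [s,t,w] - p) \<le> (\<Sum>i\<in>UNIV. \<bar>(vector [s,t,w] - p) $ i\<bar>)"
      by (rule norm_le_l1_cart)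
    also have "\<dots> < e" using st by (simp add: sum_3)
    finally have "vector [s,t,w] \<in> ball p e"
      by (simp add: dist_norm norm_minus_commute)
    then show "vector [s,t,w] \<in> U \<and> f (vector [s,t,w]) \<noteq> 0" using e by auto
  qed
qed

lemma sin_shift_nonzero:
  fixes x \<eta> :: real
  assumes "sin \<eta> \<noteq> 0"
  shows "sin x \<noteq> 0 \<or> sin (x + \<eta>) \<noteq> 0"
proof (cases "sin x = 0")
  case True
  then have "cos x \<noteq> 0" using sin_cos_squared_add[of x] by auto
  then show ?thesis using assms True by (simp add: sin_add)
qed simp

text \<open>Equality at both shifts gives \<open>sin x = 0\<close> by subtracting the addition
  formulas, and then \<open>cos \<eta> = 1\<close>.\<close>

lemma cos_not_constant:
  fixes x \<eta> :: real
  assumes "sin \<eta> \<noteq> 0"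
  shows "cos (x + \<eta>) \<noteq> cos x \<or> cos (x - \<eta>) \<noteq> cos x"
proof (rule ccontr)
  assume "\<not> ?thesis"
  then have e: "cos x * cos \<eta> - sin x * sin \<eta> = cos x" "cos x * cos \<eta> + sin x * sin \<eta> = cos x"
    by (simp_all add: cos_add cos_diff)
  then have "sin x * sin \<eta> = 0" by linarith
  then have "sin x = 0" using assms by simp
  then have "cos x \<noteq> 0" using sin_cos_squared_add[of x] by auto
  then have "cos \<eta> = 1" using e \<open>sin x = 0\<close> by simp
  then show False using assms sin_cos_squared_add[of \<eta>] by simp
qed

section \<open>The tube in frame coordinates and its differential\<close>

locale timelike_tube =
  fixes I :: "real set" and \<beta> :: "real \<Rightarrow> real^4" and F :: "nat \<Rightarrow> real \<Rightarrow> real^4"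
    and k :: "nat \<Rightarrow> real \<Rightarrow> real" and r :: real and U :: "(real^3) set"
  assumes curve: "timelike_frenet_curve I \<beta> F k"
    and r_pos: "r > 0"
    and open_U: "open U"
    and U_proj: "p \<in> U \<Longrightarrow> p $ 1 \<in> I"
    and immersion: "immersion_on (tube \<beta> F r) U"
begin

declare One_nat_def [simp del]

definition frame :: "real \<Rightarrow> real \<Rightarrow> real \<Rightarrow> real \<Rightarrow> real \<Rightarrow> real^4" where
  "frame s a b c d = a *\<^sub>R F 1 s + b *\<^sub>R F 2 s + c *\<^sub>R F 3 s + d *\<^sub>R F 4 s"

lemma frame_simps:
  "frame s a b c d + frame s a' b' c' d' = frame s (a + a') (b + b') (c + c') (d + d')"
  "frame s a b c d - frame s a' b' c' d' = frame s (a - a') (b - b') (c - c') (d - d')"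
  "- frame s a b c d = frame s (- a) (- b) (- c) (- d)"
  "x *\<^sub>R frame s a b c d = frame s (x * a) (x * b) (x * c) (x * d)"
  by (simp_all add: frame_def algebra_simps)

lemma frame_0: "frame s 0 0 0 0 = 0"
  by (simp add: frame_def)

lemma F_orthonormal:
  assumes "s \<in> I" "i \<in> {1..4}" "j \<in> {1..4}"
  shows "mink (F i s) (F j s) = (if i \<noteq> j then 0 else if i = 1 then - 1 else 1)"
  using curve assms by (simp add: timelike_frenet_curve_def)

lemma mink_frame:
  assumes "s \<in> I"
  shows "mink (frame s a b c d) (frame s a' b' c' d') = - (a * a') + b * b' + c * c' + d * d'"
  using assms by (simp add: frame_def mink_simps F_orthonormal)

lemma mink_F_frame:
  assumes "s \<in> I"
  shows "mink (frame s a b c d) (F 1 s) = - a" "mink (frame s a b c d) (F 2 s) = b"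
    "mink (frame s a b c d) (F 3 s) = c" "mink (frame s a b c d) (F 4 s) = d"
  using assms by (simp_all add: frame_def mink_simps F_orthonormal)

lemma mink_F_eq_0:
  assumes s: "s \<in> I" and "mink x (F 1 s) = 0" "mink x (F 2 s) = 0" "mink x (F 3 s) = 0" "mink x (F 4 s) = 0"
  shows "x = 0"
proof (rule mink_orthonormal_frame_nondegenerate)
  \<comment> \<open>Reindexing by the type \<open>4\<close> yields a square matrix; the last branch
    is the index 4, which equals 0 in this type.\<close>
  define f :: "4 \<Rightarrow> real^4" where "f = (\<lambda>i. if i = 1 then F 1 s else if i = 2 then F 2 s else if i = 3 then F 3 s else F 4 s)"
  show "mink (f i) (f j) = (if i \<noteq> j then 0 else if i = 1 then - 1 else 1)" for i j
    using exhaust_4[of i] exhaust_4[of j] s by (auto simp: f_def F_orthonormal)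
  show "mink x (f i) = 0" for i
    using assms by (simp add: f_def)
qed

text \<open>The factor by which the differential of the tube scales the
  \<open>F 1\<close>-component.\<close>

definition D where "D p = 1 + r * k 1 (p$1) * cos (p$2) * cos (p$3)" for p :: "real^3"

text \<open>The derivative of \<nu> = -N in direction \<open>v\<close>, expanded by the Frenet
  equations.\<close>

definition sphere_deriv :: "real^3 \<Rightarrow> real^3 \<Rightarrow> real^4" where
  "sphere_deriv p v = (let s = p$1; t = p$2; w = p$3 in
     frame s (v$1 * (k 1 s * cos t * cos w))
       (- (v$1 * k 2 s * sin t * cos w) - v$2 * sin t * cos w - v$3 * cos t * sin w)
       (v$1 * (k 2 s * cos t * cos w - k 3 s * sin w) + v$2 * cos t * cos w - v$3 * sin t * sin w)
       (v$1 * k 3 s * sin t * cos w + v$3 * cos w))"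

lemma frenet:
  assumes "s \<in> I"
  shows "(\<beta> has_vector_derivative F 1 s) (at s)"
    "(F 1 has_vector_derivative k 1 s *\<^sub>R F 2 s) (at s)"
    "(F 2 has_vector_derivative k 1 s *\<^sub>R F 1 s + k 2 s *\<^sub>R F 3 s) (at s)"
    "(F 3 has_vector_derivative - k 2 s *\<^sub>R F 2 s + k 3 s *\<^sub>R F 4 s) (at s)"
    "(F 4 has_vector_derivative - k 3 s *\<^sub>R F 3 s) (at s)"
  using curve assms by (simp_all add: timelike_frenet_curve_def)

lemma has_derivative_along_s:
  fixes f :: "real \<Rightarrow> 'a::real_normed_vector" and p :: "real^3"
  assumes "(f has_vector_derivative f') (at (p$1))"
  shows "((\<lambda>q. f (q$1)) has_derivative (\<lambda>v. v$1 *\<^sub>R f')) (at p)"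
  using has_derivative_compose[of "\<lambda>q. q$1" "\<lambda>v. v$1" p UNIV f "\<lambda>x. x *\<^sub>R f'"] assms
  by (simp add: has_vector_derivative_def bounded_linear_imp_has_derivative bounded_linear_vec_nth)

lemma tube_normal_has_derivative:
  assumes "p \<in> U"
  shows "(tube_normal F has_derivative (\<lambda>v. - sphere_deriv p v)) (at p)"
proof -
  note fr = frenet[OF U_proj[OF assms]]
  note [derivative_intros] = fr(3-5)[THEN has_derivative_along_s]
  have vn: "((\<lambda>q. q $ i) has_derivative (\<lambda>v. v $ i)) (at p)" for i :: 3
    by (simp add: bounded_linear_imp_has_derivative bounded_linear_vec_nth)
  note [derivative_intros] = vn
  show ?thesis
    unfolding tube_normal_def
    by (auto intro!: derivative_eq_intros simp: sphere_deriv_def Let_def frame_def algebra_simps fun_eq_iff)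
qed

definition dX :: "real^3 \<Rightarrow> real^3 \<Rightarrow> real^4" where
  "dX p v = v$1 *\<^sub>R F 1 (p$1) + r *\<^sub>R sphere_deriv p v"

lemma tube_has_derivative:
  assumes "p \<in> U"
  shows "(tube \<beta> F r has_derivative dX p) (at p)"
proof -
  have "tube \<beta> F r = (\<lambda>p. \<beta> (p$1) - r *\<^sub>R tube_normal F p)"
    by (simp add: tube_def tube_normal_def fun_eq_iff algebra_simps)
  moreover have "dX p = (\<lambda>v. v$1 *\<^sub>R F 1 (p$1) - r *\<^sub>R (- sphere_deriv p v))"
    by (simp add: dX_def fun_eq_iff)
  ultimately show ?thesis
    using has_derivative_diff[OF has_derivative_along_s[OF frenet(1)[OF U_proj[OF assms]]]
        has_derivative_scaleR_right[OF tube_normal_has_derivative[OF assms]]] by simp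
qed

lemma frechet_derivative_tube: "p \<in> U \<Longrightarrow> frechet_derivative (tube \<beta> F r) (at p) = dX p"
  using frechet_derivative_at[OF tube_has_derivative] by simp

lemma frechet_derivative_tube_normal:
  "p \<in> U \<Longrightarrow> frechet_derivative (tube_normal F) (at p) = (\<lambda>v. - sphere_deriv p v)"
  using frechet_derivative_at[OF tube_normal_has_derivative] by simp

lemma linear_dX: "p \<in> U \<Longrightarrow> linear (dX p)"
  using tube_has_derivative has_derivative_linear by blast

lemma inj_dX: "p \<in> U \<Longrightarrow> inj (dX p)"
  using immersion by (auto simp: immersion_on_def frechet_derivative_tube)

lemma dX_eq_0: "p \<in> U \<Longrightarrow> dX p v = 0 \<Longrightarrow> v = 0"
  using inj_dX linear_dX by (metis injD linear_0)

lemma dX_frame: "dX p v = (let s = p$1; t = p$2; w = p$3 in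
     frame s (v$1 * D p)
       (r * (- (v$1 * k 2 s * sin t * cos w) - v$2 * sin t * cos w - v$3 * cos t * sin w))
       (r * (v$1 * (k 2 s * cos t * cos w - k 3 s * sin w) + v$2 * cos t * cos w - v$3 * sin t * sin w))
       (r * (v$1 * k 3 s * sin t * cos w + v$3 * cos w)))"
proof -
  have "F 1 (p$1) = frame (p$1) 1 0 0 0" by (simp add: frame_def)
  then show ?thesis
    by (simp add: dX_def sphere_deriv_def Let_def frame_simps D_def algebra_simps)
qed

section \<open>Regularity conditions and principal curvatures\<close>

lemma cos_w_nonzero:
  assumes "p \<in> U"
  shows "cos (p$3) \<noteq> 0"
proof
  assume "cos (p$3) = 0"
  \<comment> \<open>Every component of the t-derivative has the factor
    \<open>cos (p$3)\<close>.\<close>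
  then have "dX p (axis 2 1) = 0"
    by (simp add: dX_frame Let_def axis_def frame_0)
  then have "axis 2 (1::real) = (0 :: real^3)"
    using dX_eq_0 assms by blast
  then show False by (simp add: axis_eq_0_iff)
qed

text \<open>The s-direction, corrected in t and w so that its image has no part tangent to the
  sphere: the third principal direction.\<close>

definition \<xi> :: "real^3 \<Rightarrow> real^3" where
  "\<xi> p = vector [1, k 3 (p$1) * sin (p$3) * cos (p$2) / cos (p$3) - k 2 (p$1), - (k 3 (p$1) * sin (p$2))]"

lemma dX_\<xi>:
  assumes "p \<in> U"
  shows "dX p (\<xi> p) = D p *\<^sub>R F 1 (p$1)"
proof -
  define S C S' C' where "S = sin (p$2)" "C = cos (p$2)" "S' = sin (p$3)" "C' = cos (p$3)"
  have sq: "S * S = 1 - C * C"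
    using sin_cos_squared_add[of "p$2"] by (simp add: S_C_S'_C'_def power2_eq_square)
  have nz: "C' \<noteq> 0" using cos_w_nonzero[OF assms] by (simp add: S_C_S'_C'_def)
  \<comment> \<open>\<open>1\<close> and \<open>2\<close> are the vanishing of the
    \<open>F 2\<close>- and \<open>F 3\<close>-components; the \<open>F 4\<close>-component cancels
    directly.\<close>
  have 1: "- (k 2 (p$1) * S * C') - (k 3 (p$1) * S' * C / C' - k 2 (p$1)) * S * C' + k 3 (p$1) * S * C * S' = 0"
    using nz by (simp add: field_simps)
  have "(k 3 (p$1) * S' * C / C' - k 2 (p$1)) * C * C' = k 3 (p$1) * S' * (C * C) - k 2 (p$1) * C * C'"
    using nz by (simp add: field_simps)
  also have "C * C = 1 - S * S" using sq by simp
  finally have 2: "k 2 (p$1) * C * C' - k 3 (p$1) * S' + (k 3 (p$1) * S' * C / C' - k 2 (p$1)) * C * C'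
      + k 3 (p$1) * S * S * S' = 0"
    by (simp add: algebra_simps)
  show ?thesis
    using 1 2 by (simp add: dX_frame Let_def \<xi>_def flip: S_C_S'_C'_def) (simp add: frame_def)
qed

lemma D_nonzero:
  assumes "p \<in> U"
  shows "D p \<noteq> 0"
proof
  assume "D p = 0"
  then have "\<xi> p = 0" using dX_\<xi> dX_eq_0 assms by simp
  then have "\<xi> p $ 1 = 0" by simp
  then show False by (simp add: \<xi>_def)
qed

text \<open>\<open>-dN\<close> equals \<open>sphere_deriv\<close>, which is \<open>dX p v\<close>
  without its \<open>F 1\<close> term, divided by \<open>r\<close>; that term is itself the image of
  a multiple of \<open>\<xi> p\<close>. Injectivity of \<open>dX p\<close> makes the preimage
  unique.\<close>

lemma shape_operator_tube:
  assumes "p \<in> U"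
  shows "shape_operator (tube \<beta> F r) (tube_normal F) p v = (1 / r) *\<^sub>R (v - (v$1 / D p) *\<^sub>R \<xi> p)"
proof -
  interpret linear "dX p" by (rule linear_dX[OF assms])
  have "dX p ((1 / r) *\<^sub>R (v - (v$1 / D p) *\<^sub>R \<xi> p)) = (1 / r) *\<^sub>R (dX p v - v$1 *\<^sub>R F 1 (p$1))"
    using D_nonzero[OF assms] by (simp add: scale diff dX_\<xi>[OF assms])
  also have "\<dots> = sphere_deriv p v" using r_pos by (simp add: dX_def)
  finally have eq: "dX p ((1 / r) *\<^sub>R (v - (v$1 / D p) *\<^sub>R \<xi> p)) = sphere_deriv p v" .
  have "(dX p u = - (- sphere_deriv p v)) = (u = (1 / r) *\<^sub>R (v - (v$1 / D p) *\<^sub>R \<xi> p))" for u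
    by (simp only: minus_minus inj_eq[OF inj_dX[OF assms]] flip: eq)
  then show ?thesis
    by (simp add: shape_operator_def frechet_derivative_tube frechet_derivative_tube_normal assms)
qed

text \<open>A multiset, because the position of the third curvature in the sorted list depends on
  the sign of \<open>D p\<close>.\<close>

lemma principal_curvatures_tube:
  assumes "p \<in> U"
  shows "mset (principal_curvatures (tube \<beta> F r) (tube_normal F) p) =
    {#1 / r, 1 / r, k 1 (p$1) * cos (p$2) * cos (p$3) / D p#}"
proof -
  define A where "A = matrix (shape_operator (tube \<beta> F r) (tube_normal F) p)"
  have A: "A $ i $ j = (1 / r) * ((if i = j then 1 else 0) - (if j = 1 then \<xi> p $ i / D p else 0))" for i j
    by (simp add: A_def matrix_def shape_operator_tube[OF assms] axis_def)
  have "\<xi> p $ 1 = 1" by (simp add: \<xi>_def)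
  \<comment> \<open>The entry is \<open>(1 - 1 / D p) / r\<close>, and \<open>D p - 1\<close>
    contains the factor \<open>r\<close>.\<close>
  then have A11: "A $ 1 $ 1 = k 1 (p$1) * cos (p$2) * cos (p$3) / D p"
    using D_nonzero[OF assms] r_pos by (simp add: A diff_divide_eq_iff) (simp add: D_def)
  have "charpoly A = [:- (1 / r), 1:] * [:- (1 / r), 1:] * [:- A $ 1 $ 1, 1:]"
    by (rule charpoly_splits) (auto simp: A)
  then have "proots (charpoly A) = {#1 / r, 1 / r, A $ 1 $ 1#}"
    by (simp add: proots_mult del: mult_pCons_left mult_pCons_right)
  then show ?thesis
    by (simp add: principal_curvatures_def flip: A_def A11)
qed

lemma mink_tube_normal:
  assumes "p \<in> U"
  shows "mink (tube_normal F p) (tube_normal F p) = 1"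
proof -
  have "tube_normal F p = frame (p$1) 0 (- (cos (p$2) * cos (p$3))) (- (sin (p$2) * cos (p$3))) (- sin (p$3))"
    by (simp add: tube_normal_def frame_def)
  moreover have "(cos (p$2) * cos (p$3))^2 + (sin (p$2) * cos (p$3))^2 + (sin (p$3))^2 = 1"
    by (simp add: power_mult_distrib flip: distrib_right)
  ultimately show ?thesis
    by (simp add: mink_frame U_proj assms power2_eq_square)
qed

section \<open>The third mean curvature, its gradient, and the 1-type equation in the frame\<close>

lemma mean_curv_3_tube:
  assumes "p \<in> U"
  shows "mean_curv (tube \<beta> F r) (tube_normal F) 3 p = k 1 (p$1) * cos (p$2) * cos (p$3) / (r^2 * D p)"
proof -
  define xs where "xs = principal_curvatures (tube \<beta> F r) (tube_normal F) p"
  have m: "mset xs = {#1 / r, 1 / r, k 1 (p$1) * cos (p$2) * cos (p$3) / D p#}"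
    by (simp add: xs_def principal_curvatures_tube[OF assms])
  have "length xs = 3" using arg_cong[OF m, of size] by simp
  moreover have "prod_list xs = k 1 (p$1) * cos (p$2) * cos (p$3) / (r^2 * D p)"
    using arg_cong[OF m, of prod_mset] by (simp add: prod_mset_prod_list power2_eq_square)
  \<comment> \<open>Since the normal sign is 1, the two factors \<open>(- 1) ^ 3\<close>
    cancel.\<close>
  ultimately show ?thesis
    using sum_prod_full_subsets[of xs]
    by (simp add: mean_curv_def curv_coeff_def normal_sign_def mink_tube_normal[OF assms] flip: xs_def)
qed

text \<open>Pairing with the image of \<open>\<xi> p\<close> removes the timelike component; what
  remains is spacelike, so pairing it with itself gives zero only for zero. This makes the gradient
  unique.\<close>

lemma induced_metric_nondegenerate:
  assumes "p \<in> U" and zero: "\<And>v. mink (dX p u) (dX p v) = 0"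
  shows "u = 0"
proof -
  note s = U_proj[OF assms(1)]
  obtain b c d where X: "dX p u = frame (p$1) (u$1 * D p) b c d"
    by (metis dX_frame)
  have "mink (dX p u) (F 1 (p$1)) = 0"
    using zero[of "\<xi> p"] D_nonzero[OF assms(1)] by (simp add: dX_\<xi>[OF assms(1)] mink_simps)
  then have "u$1 * D p = 0" by (simp add: X mink_F_frame[OF s])
  then have X: "dX p u = frame (p$1) 0 b c d" using X by (simp only:)
  then have "b * b + c * c + d * d = 0"
    using zero[of u] by (simp add: mink_frame[OF s])
  then have "b = 0" "c = 0" "d = 0"
    by (smt (verit) zero_le_square mult_eq_0_iff)+
  then show ?thesis
    using dX_eq_0[OF assms(1)] X by (simp add: frame_0)
qed

lemma k1_has_derivative:
  assumes "s \<in> I"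
  shows "(k 1 has_real_derivative deriv (k 1) s) (at s)"
proof -
  have "Ck_on (Suc 0) (k 1) I"
    using curve unfolding timelike_frenet_curve_def smooth_on_def by (metis atLeastAtMost_iff order_refl one_le_numeral)
  then have "k 1 differentiable (at s)" using assms by simp
  then show ?thesis by (simp add: DERIV_deriv_iff_real_differentiable)
qed

lemma mean_curv_3_has_derivative:
  assumes "p \<in> U"
  shows "(mean_curv (tube \<beta> F r) (tube_normal F) 3 has_derivative
    (\<lambda>v. (v$1 * deriv (k 1) (p$1) * cos (p$2) * cos (p$3) - v$2 * k 1 (p$1) * sin (p$2) * cos (p$3)
       - v$3 * k 1 (p$1) * cos (p$2) * sin (p$3)) / (r^2 * D p ^ 2))) (at p)" (is "(_ has_derivative ?h) _")
proof -
  define g where "g q = k 1 (q$1) * cos (q$2) * cos (q$3)" for q :: "real^3"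
  define g' where "g' v = v$1 * deriv (k 1) (p$1) * cos (p$2) * cos (p$3) - v$2 * k 1 (p$1) * sin (p$2) * cos (p$3)
       - v$3 * k 1 (p$1) * cos (p$2) * sin (p$3)" for v :: "real^3"
  have D_g: "D q = 1 + r * g q" for q by (simp add: D_def g_def)
  have vn: "((\<lambda>q. q $ i) has_derivative (\<lambda>v. v $ i)) (at p)" for i :: 3
    by (simp add: bounded_linear_imp_has_derivative bounded_linear_vec_nth)
  have "((\<lambda>q. k 1 (q$1)) has_derivative (\<lambda>v. v$1 *\<^sub>R deriv (k 1) (p$1))) (at p)"
    using k1_has_derivative[OF U_proj[OF assms]]
    by (intro has_derivative_along_s) (simp add: has_real_derivative_iff_has_vector_derivative)
  note [derivative_intros] = vn this
  have g: "(g has_derivative g') (at p)"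
    unfolding g_def g'_def
    by (auto intro!: derivative_eq_intros simp: fun_eq_iff algebra_simps)
  \<comment> \<open>H_3 is a function of the single quantity \<open>g\<close> = \<open>k 1\<close>
    cos t cos w.\<close>
  have "((\<lambda>x. x / (r^2 * (1 + r * x))) has_real_derivative 1 / (r^2 * D p ^ 2)) (at (g p))"
    using D_nonzero[OF assms] r_pos
    by (auto intro!: derivative_eq_intros simp: D_g divide_simps) (simp add: algebra_simps power2_eq_square)
  from DERIV_compose_FDERIV[OF this g]
  have *: "((\<lambda>q. g q / (r^2 * (1 + r * g q))) has_derivative ?h) (at p)"
    by (simp add: g'_def)
  show ?thesis
    \<comment> \<open>The closed formula for H_3 is available on \<open>U\<close> only.\<close>
    by (rule has_derivative_transform_within_open[OF * open_U assms])
      (simp add: mean_curv_3_tube g_def D_def mult.assoc)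
qed

text \<open>The candidate combines \<open>F 1\<close> with the part of \<open>F 2\<close> tangent to
  the sphere. Its pairing with each \<open>dX p v\<close> is the differential of H_3, and
  nondegeneracy gives uniqueness.\<close>

lemma grad_mean_curv_3:
  assumes "p \<in> U"
  defines "s \<equiv> p$1" and "a \<equiv> cos (p$2) * cos (p$3)" and "b \<equiv> sin (p$2) * cos (p$3)" and "c \<equiv> sin (p$3)"
  defines "B \<equiv> k 1 s / (r^3 * D p ^ 2)"
  shows "grad (tube \<beta> F r) (mean_curv (tube \<beta> F r) (tube_normal F) 3) p =
    frame s (- (deriv (k 1) s * a + k 1 s * k 2 s * b) / (r^2 * D p ^ 3)) (B * (1 - a * a)) (- (B * a * b)) (- (B * a * c))"
    (is "_ = ?V")
proof -
  \<comment> \<open>\<open>dX p y\<close> below is the component of \<open>F 2 s\<close> tangent to the sphere.\<close>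
  note sI = U_proj[OF assms(1), folded s_def]
  interpret linear "dX p" by (rule linear_dX[OF assms(1)])
  \<comment> \<open>Minus the derivative of H_3 along \<open>\<xi> p\<close> divided by
    \<open>D p\<close>; the sign is that of the timelike \<open>F 1\<close>.\<close>
  define \<phi> where "\<phi> = - (deriv (k 1) s * a + k 1 s * k 2 s * b) / (r^2 * D p ^ 3)"
  define y :: "real^3" where "y = vector [0, - (sin (p$2) / (r * cos (p$3))), - (cos (p$2) * sin (p$3) / r)]"
  note nz = D_nonzero[OF assms(1)] cos_w_nonzero[OF assms(1)] r_pos
  have sq: "sin (p$i) * sin (p$i) = 1 - cos (p$i) * cos (p$i)" for i
    using sin_cos_squared_add[of "p$i"] by (simp add: power2_eq_square)
  have "dX p y = frame s 0 (sin (p$2) * sin (p$2) + cos (p$2) * cos (p$2) * (sin (p$3) * sin (p$3)))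
     (- (sin (p$2) * cos (p$2) * (1 - sin (p$3) * sin (p$3)))) (- (cos (p$2) * sin (p$3) * cos (p$3)))"
    using nz by (simp add: dX_frame y_def Let_def s_def) (simp add: algebra_simps add_divide_distrib diff_divide_distrib)
  also have "\<dots> = frame s 0 (1 - a * a) (- (a * b)) (- (a * c))"
    by (simp add: sq a_def b_def c_def algebra_simps)
  finally have y: "dX p y = frame s 0 (1 - a * a) (- (a * b)) (- (a * c))" .
  have "dX p ((\<phi> / D p) *\<^sub>R \<xi> p + B *\<^sub>R y) = \<phi> *\<^sub>R F 1 s + B *\<^sub>R dX p y"
    using nz by (simp add: add scale dX_\<xi>[OF assms(1)] s_def)
  also have "\<dots> = ?V"
    unfolding \<phi>_def[symmetric] by (simp add: y frame_def algebra_simps)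
  finally have V: "?V = dX p ((\<phi> / D p) *\<^sub>R \<xi> p + B *\<^sub>R y)" ..
  have inner: "mink ?V (dX p v) = (v$1 * deriv (k 1) s * a - v$2 * k 1 s * b
       - v$3 * k 1 s * cos (p$2) * sin (p$3)) / (r^2 * D p ^ 2)" for v
  proof -
    define X1 X2 X3 X4 where X: "X1 = v$1 * D p"
      "X2 = - (v$1 * k 2 s * sin (p$2) * cos (p$3)) - v$2 * sin (p$2) * cos (p$3) - v$3 * cos (p$2) * sin (p$3)"
      "X3 = v$1 * (k 2 s * cos (p$2) * cos (p$3) - k 3 s * sin (p$3)) + v$2 * cos (p$2) * cos (p$3) - v$3 * sin (p$2) * sin (p$3)"
      "X4 = v$1 * k 3 s * sin (p$2) * cos (p$3) + v$3 * cos (p$3)"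
    \<comment> \<open>Tangent vectors are orthogonal to \<nu>, so the \<nu>-part of the candidate
      drops out.\<close>
    have "a * X2 + b * X3 + c * X4 = v$3 * cos (p$3) * sin (p$3) * (1 - sin (p$2) * sin (p$2) - cos (p$2) * cos (p$2))"
      unfolding X a_def b_def c_def by algebra
    moreover have "1 - sin (p$2) * sin (p$2) - cos (p$2) * cos (p$2) = 0" by (simp add: sq)
    ultimately have orth: "a * X2 + b * X3 + c * X4 = 0" by (simp only: mult_zero_right)
    have "dX p v = frame s X1 (r * X2) (r * X3) (r * X4)"
      by (simp add: dX_frame Let_def X s_def)
    then have "mink ?V (dX p v) = - (\<phi> * X1) + r * B * (X2 - a * (a * X2 + b * X3 + c * X4))"
      unfolding \<phi>_def[symmetric] by (simp add: mink_frame[OF sI] algebra_simps)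
    also have "\<dots> = - (\<phi> * X1) + r * B * X2" by (simp add: orth)
    also have "\<phi> * X1 = v$1 * (- (deriv (k 1) s * a + k 1 s * k 2 s * b)) / (r^2 * D p ^ 2)"
      using nz by (simp add: \<phi>_def X power2_eq_square power3_eq_cube mult_ac)
    also have "r * B * X2 = k 1 s * X2 / (r^2 * D p ^ 2)"
      using nz by (simp add: B_def power2_eq_square power3_eq_cube)
    finally show ?thesis
      by (simp add: X a_def b_def algebra_simps flip: add_divide_distrib diff_divide_distrib)
  qed
  have f': "frechet_derivative (mean_curv (tube \<beta> F r) (tube_normal F) 3) (at p) v = mink ?V (dX p v)" for v
    using frechet_derivative_at[OF mean_curv_3_has_derivative[OF assms(1)], symmetric]
    unfolding inner by (simp add: s_def a_def b_def mult.assoc)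
  show ?thesis
    unfolding grad_def frechet_derivative_tube[OF assms(1)] f'
  proof (rule the_equality)
    show "?V \<in> range (dX p) \<and> (\<forall>v. mink ?V (dX p v) = mink ?V (dX p v))"
      using V by blast
  next
    fix W assume W: "W \<in> range (dX p) \<and> (\<forall>v. mink W (dX p v) = mink ?V (dX p v))"
    then obtain u where u: "W = dX p u" by blast
    define u' where "u' = (\<phi> / D p) *\<^sub>R \<xi> p + B *\<^sub>R y"
    have "u - u' = 0"
      by (rule induced_metric_nondegenerate[OF assms(1)])
        (use W u V in \<open>simp add: diff mink_simps u'_def\<close>)
    then show "W = ?V" using u V u'_def by simp
  qed
qed

text \<open>The H_1 H_3 term, the \<open>m\<close> term and the \<nu>-part of the gradient are all
  parallel to \<nu>, so one unknown \<open>G\<close> absorbs them.\<close>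

lemma L2_Gauss_eq_decomposition:
  assumes "p \<in> U" and eq: "L2_Gauss (tube \<beta> F r) (tube_normal F) p = m *\<^sub>R tube_normal F p + n *\<^sub>R C"
  defines "s \<equiv> p$1" and "a \<equiv> cos (p$2) * cos (p$3)" and "b \<equiv> sin (p$2) * cos (p$3)" and "c \<equiv> sin (p$3)"
  obtains G where
    "n * mink C (F 1 s) = - (deriv (k 1) s * a + k 1 s * k 2 s * b) / (r^2 * D p ^ 3)"
    "n * mink C (F 2 s) = G * a - k 1 s / (r^3 * D p ^ 2)"
    "n * mink C (F 3 s) = G * b"
    "n * mink C (F 4 s) = G * c"
proof -
  note sI = U_proj[OF assms(1), folded s_def]
  define X N where "X = tube \<beta> F r" and "N = tube_normal F"
  define \<phi> where "\<phi> = - (deriv (k 1) s * a + k 1 s * k 2 s * b) / (r^2 * D p ^ 3)"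
  define B where "B = k 1 s / (r^3 * D p ^ 2)"
  define h where "h = 3 * mean_curv X N 1 p * mean_curv X N 3 p + m"
  have N: "N p = frame s 0 (- a) (- b) (- c)"
    by (simp add: N_def tube_normal_def frame_def s_def a_def b_def c_def)
  have "n *\<^sub>R C = L2_Gauss X N p - m *\<^sub>R N p"
    using eq by (simp add: X_def N_def)
  also have "L2_Gauss X N p = - (grad X (mean_curv X N 3) p + (3 * mean_curv X N 1 p * mean_curv X N 3 p) *\<^sub>R N p)"
    using mink_tube_normal[OF assms(1)] by (simp add: L2_Gauss_def normal_sign_def N_def)
  also have "\<dots> - m *\<^sub>R N p = - grad X (mean_curv X N 3) p - h *\<^sub>R N p"
    by (simp add: h_def algebra_simps)
  also have "grad X (mean_curv X N 3) p = frame s \<phi> (B * (1 - a * a)) (- (B * a * b)) (- (B * a * c))"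
    unfolding X_def N_def \<phi>_def B_def s_def a_def b_def c_def by (rule grad_mean_curv_3[OF assms(1)])
  also have "- \<dots> - h *\<^sub>R N p = frame s (- \<phi>) ((B * a + h) * a - B) ((B * a + h) * b) ((B * a + h) * c)"
    by (simp add: N frame_simps algebra_simps)
  finally have "n *\<^sub>R C = frame s (- \<phi>) ((B * a + h) * a - B) ((B * a + h) * b) ((B * a + h) * c)" .
  then have C: "n * mink C Y = mink (frame s (- \<phi>) ((B * a + h) * a - B) ((B * a + h) * b) ((B * a + h) * c)) Y" for Y
    by (metis mink_simps(3))
  show thesis
    by (rule that[of "B * a + h"]; unfold C mink_F_frame[OF sI]) (simp_all add: \<phi>_def B_def)
qed

section \<open>The contradiction from the frame components of the constant vector\<close>

lemma mink_F_has_derivative: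
  assumes "s \<in> I"
  shows "((\<lambda>s. mink C (F 1 s)) has_real_derivative k 1 s * mink C (F 2 s)) (at s)"
    "((\<lambda>s. mink C (F 3 s)) has_real_derivative - k 2 s * mink C (F 2 s) + k 3 s * mink C (F 4 s)) (at s)"
  using frenet(2,4)[OF assms, THEN bounded_linear.has_vector_derivative[OF bounded_linear_mink[of C]]]
  by (simp_all add: has_real_derivative_iff_has_vector_derivative mink_simps)

lemma not_generalized_L2_1_type:
  "\<not> generalized_L2_1_type_Gauss_map U (tube \<beta> F r) (tube_normal F)"
proof
  assume "generalized_L2_1_type_Gauss_map U (tube \<beta> F r) (tube_normal F)"
  then obtain m n C p0 where n: "smooth_on n U" "p0 \<in> U" "n p0 \<noteq> 0" and "C \<noteq> 0"
    and eq: "\<And>p. p \<in> U \<Longrightarrow> L2_Gauss (tube \<beta> F r) (tube_normal F) p = m p *\<^sub>R tube_normal F p + n p *\<^sub>R C"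
    unfolding generalized_L2_1_type_Gauss_map_def by blast
  from n(1) have "Ck_on 0 n U" unfolding smooth_on_def by blast
  then have "continuous_on U n" by simp
  from continuous_nonzero_on_box[OF open_U this n(2,3)] obtain \<delta> where "\<delta> > 0" and
    box: "\<And>s t w. \<bar>s - p0$1\<bar> < \<delta> \<Longrightarrow> \<bar>t - p0$2\<bar> < \<delta> \<Longrightarrow> \<bar>w - p0$3\<bar> < \<delta> \<Longrightarrow>
       vector [s,t,w] \<in> U \<and> n (vector [s,t,w]) \<noteq> 0" by blast
  define S T W where "S = {s. \<bar>s - p0$1\<bar> < \<delta>}" and "T = {t. \<bar>t - p0$2\<bar> < \<delta>}" and "W = {w. \<bar>w - p0$3\<bar> < \<delta>}"
  \<comment> \<open>Half of \<open>\<delta>\<close> keeps shifted parameters in the box; the bound 1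
    < pi keeps \<open>sin \<eta>\<close> positive.\<close>
  define \<eta> where "\<eta> = min (\<delta> / 2) 1"
  have \<eta>: "\<eta> > 0" "\<eta> < \<delta>" "\<eta> \<le> 1" using \<open>\<delta> > 0\<close> by (auto simp: \<eta>_def)
  then have sin_\<eta>: "sin \<eta> \<noteq> 0"
    using sin_gt_zero[of \<eta>] pi_gt3 by simp
  have TW: "p0$2 \<in> T" "p0$2 + \<eta> \<in> T" "p0$2 - \<eta> \<in> T" "p0$3 \<in> W" "p0$3 + \<eta> \<in> W"
    using \<eta> by (auto simp: T_def W_def)
  have "open S"
    using open_ball[of "p0$1" \<delta>] by (simp add: S_def ball_def dist_real_def abs_minus_commute)
  have "p0$1 \<in> S" using \<open>\<delta> > 0\<close> by (simp add: S_def)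
  have SI: "s \<in> I" if "s \<in> S" for s
    using box[of s "p0$2" "p0$3"] U_proj that \<open>\<delta> > 0\<close> by (fastforce simp: S_def)
  have pt: "vector [s,t,w] \<in> U" "n (vector [s,t,w]) \<noteq> 0" if "s \<in> S" "t \<in> T" "w \<in> W" for s t w
    using box that by (auto simp: S_def T_def W_def)
  have cosw: "cos w \<noteq> 0" if "w \<in> W" for w
    using cos_w_nonzero[OF pt(1)[OF \<open>p0$1 \<in> S\<close> TW(1) that]] by simp
  have deriv_zero_on_S: "f' = 0" if "(f has_real_derivative f') (at s)" "s \<in> S" "\<And>s. s \<in> S \<Longrightarrow> f s = 0"
    for f :: "real \<Rightarrow> real" and f' s
    using has_field_derivative_transform_within_open[OF that(1) \<open>open S\<close> that(2), of "\<lambda>_. 0"] that(3)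
    by (metis DERIV_const DERIV_unique)

  define c where "c i s = mink C (F i s)" for i s
  define \<Delta> where "\<Delta> s t w = 1 + r * k 1 s * cos t * cos w" for s t w
  have \<Delta>: "\<Delta> s t w \<noteq> 0" if "s \<in> S" "t \<in> T" "w \<in> W" for s t w
    using D_nonzero[OF pt(1)[OF that]] by (simp add: D_def \<Delta>_def)
  have dec: "\<exists>n G. n \<noteq> 0 \<and> n * c 1 s = - (deriv (k 1) s * cos t * cos w + k 1 s * k 2 s * sin t * cos w) / (r^2 * \<Delta> s t w ^ 3)
      \<and> n * c 2 s = G * cos t * cos w - k 1 s / (r^3 * \<Delta> s t w ^ 2) \<and> n * c 3 s = G * sin t * cos w \<and> n * c 4 s = G * sin w"
    if "s \<in> S" "t \<in> T" "w \<in> W" for s t w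
    by (rule L2_Gauss_eq_decomposition[OF pt(1)[OF that] eq[OF pt(1)[OF that]]])
      (use pt(2)[OF that] in \<open>auto simp: c_def \<Delta>_def D_def mult.assoc\<close>)
  \<comment> \<open>Cross-multiplication eliminates \<open>n\<close> and \<open>G\<close>, which may
    depend on t and w.\<close>
  have c34: "c 3 s * sin w = c 4 s * sin t * cos w" if stw: "s \<in> S" "t \<in> T" "w \<in> W" for s t w
  proof -
    obtain n G where "n \<noteq> 0" "n * c 3 s = G * sin t * cos w" "n * c 4 s = G * sin w"
      using dec[OF stw] by blast
    then have "n * (c 3 s * sin w) = n * (c 4 s * sin t * cos w)"
      by (simp add: mult.assoc[symmetric])
    then show ?thesis using \<open>n \<noteq> 0\<close> by simp
  qed
  \<comment> \<open>For fixed t this is a homogeneous linear system in \<open>c 3 s\<close> and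
    \<open>q\<close>; its equations at \<open>w\<close> and \<open>w + \<eta>\<close> are
    independent because \<open>sin \<eta>\<close> is nonzero.\<close>
  have c3: "c 3 s = 0" if s: "s \<in> S" for s
  proof -
    define w where "w = p0$3"
    define q where "q = c 4 s * sin (p0$2)"
    have e: "c 3 s * sin w = q * cos w" "c 3 s * sin (w + \<eta>) = q * cos (w + \<eta>)"
      using c34[OF s TW(1)] TW(4,5) by (auto simp: w_def q_def)
    have "c 3 s * sin \<eta> = c 3 s * sin (w + \<eta> - w)" by simp
    also have "\<dots> = (c 3 s * sin (w + \<eta>)) * cos w - (c 3 s * sin w) * cos (w + \<eta>)"
      unfolding sin_diff by (simp add: algebra_simps)
    also have "\<dots> = 0" unfolding e by simp
    finally show ?thesis using sin_\<eta> by simp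
  qed
  have c4: "c 4 s = 0" if s: "s \<in> S" for s
  proof -
    obtain t where t: "t \<in> T" "sin t \<noteq> 0" using sin_shift_nonzero[OF sin_\<eta>] TW by blast
    then show ?thesis using c34[OF s t(1) TW(4)] c3[OF s] cosw[OF TW(4)] by simp
  qed
  obtain w where w: "w \<in> W" "sin w \<noteq> 0" using sin_shift_nonzero[OF sin_\<eta>] TW by blast
  \<comment> \<open>Where \<open>sin w\<close> is nonzero, \<open>c 4 s = 0\<close> forces
    \<open>G = 0\<close>.\<close>
  have dec': "\<exists>n. n \<noteq> 0 \<and> n * c 1 s = - (deriv (k 1) s * cos t * cos w + k 1 s * k 2 s * sin t * cos w) / (r^2 * \<Delta> s t w ^ 3)
      \<and> n * c 2 s = - k 1 s / (r^3 * \<Delta> s t w ^ 2)" if st: "s \<in> S" "t \<in> T" for s t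
    using dec[OF st w(1)] w(2) c4[OF st(1)] by auto
  have c2: "c 2 s = 0 \<longleftrightarrow> k 1 s = 0" if s: "s \<in> S" for s
  proof -
    obtain n where "n \<noteq> 0" "n * c 2 s = - k 1 s / (r^3 * \<Delta> s (p0$2) w ^ 2)"
      using dec'[OF s TW(1)] by blast
    then show ?thesis using \<Delta>[OF s TW(1) w(1)] r_pos by auto
  qed
  have k12: "k 1 s * k 2 s = 0" if s: "s \<in> S" for s
  proof -
    have "- k 2 s * c 2 s + k 3 s * c 4 s = 0"
      by (rule deriv_zero_on_S[OF mink_F_has_derivative(2)[OF SI[OF s], of C, folded c_def] s c3])
    then show ?thesis using c2[OF s] c4[OF s] by auto
  qed
  \<comment> \<open>Cross-multiplying the first two components eliminates \<open>n\<close>; the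
    \<open>k 2\<close> term is gone by \<open>k12\<close>.\<close>
  have c1: "r * deriv (k 1) s * c 2 s * cos t * cos w = c 1 s * k 1 s * \<Delta> s t w" if s: "s \<in> S" "t \<in> T" for s t
  proof -
    obtain n where n: "n \<noteq> 0" and 1: "n * c 1 s = - (deriv (k 1) s * cos t * cos w) / (r^2 * \<Delta> s t w ^ 3)"
        and 2: "n * c 2 s = - k 1 s / (r^3 * \<Delta> s t w ^ 2)"
      using dec'[OF s] k12[OF s(1)] by auto
    have nz: "\<Delta> s t w \<noteq> 0" "r \<noteq> 0" using \<Delta>[OF s w(1)] r_pos by auto
    have "n * (r * deriv (k 1) s * c 2 s * cos t * cos w) = (n * c 2 s) * (r * deriv (k 1) s * cos t * cos w)" by simp
    also have "\<dots> = (- (deriv (k 1) s * cos t * cos w) / (r^2 * \<Delta> s t w ^ 3)) * (k 1 s * \<Delta> s t w)"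
      unfolding 2 using nz by (simp add: power2_eq_square power3_eq_cube)
    also have "\<dots> = n * (c 1 s * k 1 s * \<Delta> s t w)" unfolding 1[symmetric] by simp
    finally show ?thesis using n by simp
  qed
  have kc1: "k 1 s * c 1 s = 0" if s: "s \<in> S" for s
  proof -
    \<comment> \<open>\<open>c1\<close> is affine in \<open>cos t\<close>: \<open>y\<close> collects
      the coefficient of \<open>cos t\<close>, and two values of \<open>cos t\<close> force
      \<open>y = 0\<close>.\<close>
    define y where "y = (r * deriv (k 1) s * c 2 s - c 1 s * k 1 s * r * k 1 s) * cos w"
    have y: "y * cos t = c 1 s * k 1 s" if "t \<in> T" for t
      using c1[OF s that] by (simp add: y_def \<Delta>_def algebra_simps)
    obtain t where t: "t \<in> T" "cos t \<noteq> cos (p0$2)"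
      using cos_not_constant[OF sin_\<eta>] TW by blast
    have "y * cos t = y * cos (p0$2)" using y t TW(1) by simp
    then have "y = 0" using t(2) by simp
    then show ?thesis using y[OF t(1)] by auto
  qed
  have k1: "k 1 s = 0" if s: "s \<in> S" for s
  proof (rule ccontr)
    assume nz: "k 1 s \<noteq> 0"
    \<comment> \<open>The derivative of \<open>k 1 s * c 1 s\<close>. Where \<open>k 1 s\<close> is
      nonzero, \<open>c 1 s\<close> vanishes, so \<open>c 2 s\<close> would vanish too, against
      \<open>c2\<close>.\<close>
    have "deriv (k 1) s * c 1 s + k 1 s * c 2 s * k 1 s = 0"
    proof (rule deriv_zero_on_S[OF _ s kc1])
      show "((\<lambda>s. k 1 s * c 1 s) has_real_derivative deriv (k 1) s * c 1 s + k 1 s * c 2 s * k 1 s) (at s)"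
        using DERIV_mult[OF k1_has_derivative[OF SI[OF s]] mink_F_has_derivative(1)[OF SI[OF s]]]
        by (simp add: c_def algebra_simps)
    qed
    then show False using nz kc1[OF s] c2[OF s] by simp
  qed
  define s where "s = p0$1"
  have s: "s \<in> S" using \<open>p0$1 \<in> S\<close> by (simp add: s_def)
  have "deriv (k 1) s = 0"
    by (rule deriv_zero_on_S[OF k1_has_derivative[OF SI[OF s]] s k1])
  then have "c 1 s = 0"
    using dec'[OF s TW(1)] k1[OF s] by auto
  then have "C = 0"
    using mink_F_eq_0[OF SI[OF s], of C] c2[OF s] c3[OF s] c4[OF s] k1[OF s] by (simp add: c_def)
  then show False using \<open>C \<noteq> 0\<close> by simp
qed

end

theorem theorem5:
  fixes I :: "real set" and \<beta> :: "real \<Rightarrow> real^4" and F :: "nat \<Rightarrow> real \<Rightarrow> real^4"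
    and k :: "nat \<Rightarrow> real \<Rightarrow> real" and r :: real and U :: "(real^3) set"
  assumes "open I" and "is_interval I" and "I \<noteq> {}"
    and "timelike_frenet_curve I \<beta> F k"
    and "r > 0"
    and "open U" and "connected U" and "(\<lambda>p. p$1) ` U = I"
    and "immersion_on (tube \<beta> F r) U"
  shows "\<not> generalized_L2_1_type_Gauss_map U (tube \<beta> F r) (tube_normal F)"
proof -
  interpret timelike_tube I \<beta> F k r U
    using assms by unfold_locales auto
  show ?thesis by (rule not_generalized_L2_1_type)
qed

end
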